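(* Suppose that $|\mathcal{X}|\ge2$. Let $\phi:\mathbb{R}\to[0,\infty)$ be a non-negative classification-calibrated loss function such that $\phi(x)\to0$ as $x\to+\infty$. Then for any $\xi>0$ and any $\theta\in[0,1]$ there exist a probability distribution of $(\mathbf{X},Y)$ on $\mathcal{X}\times\{\pm1\}$, a function $f:\mathbb{R}^d\to\mathbb{R}$, and a regularization parameter $\lambda>0$ such that $$\mathcal{R}_{\mathrm{rob}}(f)-\mathcal{R}_{\mathrm{nat}}^*=\theta$$ and $$\psi\Big(\theta-\mathbb{E}\max_{\mathbf{X}'\in\mathbb{B}(\mathbf{X},\epsilon)}\phi\big(f(\mathbf{X}')f(\mathbf{X})/\lambda\big)\Big)\le\mathcal{R}_\phi(f)-\mathcal{R}_\phi^*\le\psi\Big(\theta-\mathbb{E}\max_{\mathbf{X}'\in\mathbb{B}(\mathbf{X},\epsilon)}\phi\big(f(\mathbf{X}')f(\mathbf{X})/\lambda\big)\Big)+\xi.$$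
   Context: Setting: $\mathcal{X}\subseteq\mathbb{R}^d$ is the instance space, $\|\cdot\|$ is a norm on $\mathbb{R}^d$, $\epsilon$ is a fixed perturbation radius, and $(\mathbf{X},Y)$ is a random pair with values in $\mathcal{X}\times\{-1,+1\}$; expectations are with respect to its distribution. Notation: $\mathbb{B}(\mathbf{x},\epsilon)=\{\mathbf{x}'\in\mathcal{X}:\|\mathbf{x}'-\mathbf{x}\|\le\epsilon\}$. Risks: $\mathcal{R}_{\mathrm{rob}}(f)=\mathbb{E}\,\mathbf{1}\{\exists\,\mathbf{X}'\in\mathbb{B}(\mathbf{X},\epsilon)\text{ s.t. }f(\mathbf{X}')Y\le0\}$; $\mathcal{R}_{\mathrm{nat}}(f)=\mathbb{E}\,\mathbf{1}\{f(\mathbf{X})Y\le0\}$; $\mathcal{R}_{\mathrm{nat}}^*$ is the optimal natural error, i.e. the infimum of $\mathcal{R}_{\mathrm{nat}}(f)$ over measurable $f$; $\mathcal{R}_\phi(f)=\mathbb{E}\,\phi(f(\mathbf{X})Y)$; $\mathcal{R}_\phi^*$ is the minimum (infimum) of $\mathcal{R}_\phi(f)$ over measurable $f$. A maximum that is not attained is read as a supremum. Classification calibration: for $\eta\in[0,1]$ and $\alpha\in\mathbb{R}$ let $C_\eta(\alpha)=\eta\phi(\alpha)+(1-\eta)\phi(-\alpha)$, $H(\eta)=\inf_{\alpha\in\mathbb{R}}C_\eta(\alpha)$, and $H^-(\eta)=\inf_{\alpha:\,\alpha(2\eta-1)\le0}C_\eta(\alpha)$. The loss $\phi$ is classification-calibrated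 if $H^-(\eta)>H(\eta)$ for every $\eta\ne1/2$. $\psi$-transform: $\tilde\psi(\theta)=H^-\big(\tfrac{1+\theta}{2}\big)-H\big(\tfrac{1+\theta}{2}\big)$ for $\theta\in[0,1]$, and $\psi:[0,1]\to[0,\infty)$ is the bi-conjugate $\psi=\tilde\psi^{**}$, i.e. the largest convex lower bound on $\tilde\psi$.
   Formalization: The loss φ is additionally assumed upper semicontinuous at 0 (limsup of φ(x) as x→0 is at most φ(0)), without which the claim fails; ψ is extended by 0 to negative arguments. *)

theory Defs
  imports "HOL-Probability.Probability"
begin

section \<open>Instance space and distributions\<close>

definition is_norm :: "('v::real_vector \<Rightarrow> real) \<Rightarrow> bool" where
  "is_norm N \<longleftrightarrow>
     (\<forall>v. 0 \<le> N v) \<and> (\<forall>v. N v = 0 \<longleftrightarrow> v = 0) \<and>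
     (\<forall>c v. N (c *\<^sub>R v) = \<bar>c\<bar> * N v) \<and> (\<forall>v w. N (v + w) \<le> N v + N w)"

definition pert_ball ::
  "'v::real_vector set \<Rightarrow> ('v \<Rightarrow> real) \<Rightarrow> real \<Rightarrow> 'v \<Rightarrow> 'v set" where
  "pert_ball X N eps x = {x' \<in> X. N (x' - x) \<le> eps}"

text \<open>
  Laws of a pair \<open>(X, Y)\<close> with values in \<open>\<X> \<times> {-1, 1}\<close>. The first factor carries the trace of the
  Borel sets, so the set \<open>\<X>\<close> need not be a Borel set.
\<close>
definition labelled_dist :: "'v::topological_space set \<Rightarrow> ('v \<times> real) measure \<Rightarrow> bool" where
  "labelled_dist X P \<longleftrightarrow>
     prob_space P \<and> sets P = sets (restrict_space borel X \<Otimes>\<^sub>M count_space {-1, 1})"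

section \<open>Risks\<close>

text \<open>
  The integrands are named separately from their expectations: the Bochner integral of a function
  that is not integrable is \<open>0\<close>, so integrability has to be mentioned where a risk is used.
\<close>

definition rob_loss ::
  "'v::real_vector set \<Rightarrow> ('v \<Rightarrow> real) \<Rightarrow> real \<Rightarrow> ('v \<Rightarrow> real) \<Rightarrow> 'v \<times> real \<Rightarrow> real" where
  "rob_loss X N eps f = (\<lambda>(x, y). of_bool (\<exists>x' \<in> pert_ball X N eps x. f x' * y \<le> 0))"

definition nat_loss :: "('v \<Rightarrow> real) \<Rightarrow> 'v \<times> real \<Rightarrow> real" where
  "nat_loss f = (\<lambda>(x, y). of_bool (f x * y \<le> 0))"

definition phi_loss :: "(real \<Rightarrow> real) \<Rightarrow> ('v \<Rightarrow> real) \<Rightarrow> 'v \<times> real \<Rightarrow> real" where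
  "phi_loss \<phi> f = (\<lambda>(x, y). \<phi> (f x * y))"

definition reg_loss ::
  "(real \<Rightarrow> real) \<Rightarrow> 'v::real_vector set \<Rightarrow> ('v \<Rightarrow> real) \<Rightarrow> real \<Rightarrow> ('v \<Rightarrow> real) \<Rightarrow> real
     \<Rightarrow> 'v \<times> real \<Rightarrow> real" where
  "reg_loss \<phi> X N eps f lam = (\<lambda>(x, y). SUP x' \<in> pert_ball X N eps x. \<phi> (f x' * f x / lam))"

definition R_rob ::
  "'v::real_vector set \<Rightarrow> ('v \<Rightarrow> real) \<Rightarrow> real \<Rightarrow> ('v \<times> real) measure \<Rightarrow> ('v \<Rightarrow> real) \<Rightarrow> real" where
  "R_rob X N eps P f = integral\<^sup>L P (rob_loss X N eps f)"

definition R_nat :: "('v \<times> real) measure \<Rightarrow> ('v \<Rightarrow> real) \<Rightarrow> real" where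
  "R_nat P f = integral\<^sup>L P (nat_loss f)"

definition R_nat_opt :: "('v::topological_space \<times> real) measure \<Rightarrow> real" where
  "R_nat_opt P = (INF f \<in> borel_measurable borel. R_nat P f)"

definition R_phi :: "(real \<Rightarrow> real) \<Rightarrow> ('v \<times> real) measure \<Rightarrow> ('v \<Rightarrow> real) \<Rightarrow> real" where
  "R_phi \<phi> P f = integral\<^sup>L P (phi_loss \<phi> f)"

text \<open>
  Measurable \<open>f\<close> with infinite \<open>\<phi>\<close>-risk do not affect the infimum, and are left out because
  their Bochner integral would be \<open>0\<close>. The zero function is always admitted.
\<close>
definition R_phi_opt :: "(real \<Rightarrow> real) \<Rightarrow> ('v::topological_space \<times> real) measure \<Rightarrow> real" where
  "R_phi_opt \<phi> P =
     (INF f \<in> {f \<in> borel_measurable borel. integrable P (phi_loss \<phi> f)}. R_phi \<phi> P f)"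

definition R_reg ::
  "(real \<Rightarrow> real) \<Rightarrow> 'v::real_vector set \<Rightarrow> ('v \<Rightarrow> real) \<Rightarrow> real \<Rightarrow> ('v \<times> real) measure
     \<Rightarrow> ('v \<Rightarrow> real) \<Rightarrow> real \<Rightarrow> real" where
  "R_reg \<phi> X N eps P f lam = integral\<^sup>L P (reg_loss \<phi> X N eps f lam)"

text \<open>
  All the expectations formed from \<open>f\<close> exist, and the suprema in the regularizer are finite
  (the supremum of a set of reals that is not bounded above is unspecified).
\<close>
definition risks_exist ::
  "(real \<Rightarrow> real) \<Rightarrow> 'v::{real_vector, topological_space} set \<Rightarrow> ('v \<Rightarrow> real) \<Rightarrow> real
     \<Rightarrow> ('v \<times> real) measure \<Rightarrow> ('v \<Rightarrow> real) \<Rightarrow> real \<Rightarrow> bool" where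
  "risks_exist \<phi> X N eps P f lam \<longleftrightarrow>
     f \<in> borel_measurable borel \<and>
     integrable P (rob_loss X N eps f) \<and>
     integrable P (phi_loss \<phi> f) \<and>
     (\<forall>x\<in>X. bdd_above ((\<lambda>x'. \<phi> (f x' * f x / lam)) ` pert_ball X N eps x)) \<and>
     integrable P (reg_loss \<phi> X N eps f lam)"

section \<open>Classification calibration and the psi-transform\<close>

definition C_risk :: "(real \<Rightarrow> real) \<Rightarrow> real \<Rightarrow> real \<Rightarrow> real" where
  "C_risk \<phi> \<eta> \<alpha> = \<eta> * \<phi> \<alpha> + (1 - \<eta>) * \<phi> (- \<alpha>)"

definition H_opt :: "(real \<Rightarrow> real) \<Rightarrow> real \<Rightarrow> real" where
  "H_opt \<phi> \<eta> = (INF \<alpha>. C_risk \<phi> \<eta> \<alpha>)"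

definition H_minus :: "(real \<Rightarrow> real) \<Rightarrow> real \<Rightarrow> real" where
  "H_minus \<phi> \<eta> = (INF \<alpha> \<in> {\<alpha>. \<alpha> * (2 * \<eta> - 1) \<le> 0}. C_risk \<phi> \<eta> \<alpha>)"

definition classification_calibrated :: "(real \<Rightarrow> real) \<Rightarrow> bool" where
  "classification_calibrated \<phi> \<longleftrightarrow> (\<forall>\<eta>\<in>{0..1}. \<eta> \<noteq> 1 / 2 \<longrightarrow> H_minus \<phi> \<eta> > H_opt \<phi> \<eta>)"

definition psi_tilde :: "(real \<Rightarrow> real) \<Rightarrow> real \<Rightarrow> real" where
  "psi_tilde \<phi> \<theta> = H_minus \<phi> ((1 + \<theta>) / 2) - H_opt \<phi> ((1 + \<theta>) / 2)"

text \<open>Legendre--Fenchel conjugate and bi-conjugate of a function with effective domain \<open>[0, 1]\<close>.\<close>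
definition conjugate01 :: "(real \<Rightarrow> real) \<Rightarrow> real \<Rightarrow> real" where
  "conjugate01 g s = (SUP t \<in> {0..1}. s * t - g t)"

definition biconjugate01 :: "(real \<Rightarrow> real) \<Rightarrow> real \<Rightarrow> real" where
  "biconjugate01 g t = (SUP s. s * t - conjugate01 g s)"

text \<open>
  The function \<open>\<psi>\<close> lives on \<open>[0, 1]\<close>, with \<open>\<psi> 0 = 0\<close>. It is extended to negative arguments by \<open>0\<close>, as
  a nondecreasing convex function: then \<open>\<psi> t \<le> r\<close> holds for \<open>r \<ge> 0\<close> and \<open>t < 0\<close>, just as
  \<open>t \<le> \<psi>\<^sup>-\<^sup>1 r\<close> does.
\<close>
definition psi :: "(real \<Rightarrow> real) \<Rightarrow> real \<Rightarrow> real" where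
  "psi \<phi> t = (if t < 0 then 0 else biconjugate01 (psi_tilde \<phi>) t)"

section \<open>Upper semicontinuity at the decision threshold\<close>

text \<open>
  Holds if \<open>\<phi>\<close> is continuous at \<open>0\<close>, and for the loss \<open>1{x \<le> 0}\<close>. It lets scores \<open>\<alpha> \<noteq> 0\<close> of
  either sign come arbitrarily close to (or below) the value of \<open>C_risk \<phi> \<eta>\<close> at \<open>\<alpha> = 0\<close>; the score
  \<open>0\<close> itself is an error for both labels, and its regularizer \<open>\<phi> (0 / \<lambda>) = \<phi> 0\<close> does not vanish as
  \<open>\<lambda> \<rightarrow> 0\<close>. Calibration does not imply it, and the theorem fails without it: the loss with values
  \<open>1\<close>, \<open>1/2\<close>, \<open>0\<close> on \<open>x < 0\<close>, \<open>x = 0\<close>, \<open>x > 0\<close> is calibrated with \<open>\<psi> t = t/2\<close>. If \<open>\<epsilon> = 0\<close>, or if the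
  points of \<open>\<X>\<close> are more than \<open>\<epsilon>\<close> apart, \<open>\<theta> = 1\<close> forces an error almost surely and optimal risks \<open>0\<close>.
  With \<open>p = P(f(X) = 0)\<close> the regularizer is then \<open>p/2\<close> and the excess \<open>\<phi>\<close>-risk is \<open>1 - p/2\<close>, which
  exceeds \<open>\<psi> (1 - p/2) = 1/2 - p/4\<close> by at least \<open>1/4\<close>.
\<close>
definition usc_at_zero :: "(real \<Rightarrow> real) \<Rightarrow> bool" where
  "usc_at_zero \<phi> \<longleftrightarrow> (\<forall>e>0. \<forall>\<^sub>F x in at 0. \<phi> x < \<phi> 0 + e)"

end

theory Submission
  imports Defs
begin

text \<open>
  Up to \<open>\<xi> / 3\<close>, the value \<open>\<psi> \<theta>\<close> is a convex combination of two values of \<open>psi_tilde\<close> at \<open>t1\<close> and \<open>t2\<close>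
  with \<open>w * t1 + (1 - w) * t2 = \<theta>\<close>. Put mass \<open>w\<close> and \<open>1 - w\<close> on two points of \<open>\<X>\<close>, with label \<open>1\<close> having
  conditional probability \<open>(1 + t1) / 2\<close> and \<open>(1 + t2) / 2\<close>. A score that is negative everywhere and
  nearly attains \<open>H_minus\<close> at both points errs exactly on the label \<open>1\<close>, with or without a
  perturbation, so its excess robust error is \<open>\<theta>\<close>, while its excess \<open>\<phi>\<close>-risk is nearly the convex
  combination. As the score has constant sign and is bounded away from \<open>0\<close>, the regularizer tends
  to \<open>0\<close> with \<open>\<lambda>\<close>, and \<open>\<psi>\<close>, a supremum of affine functions, is lower semicontinuous.
\<close>

section \<open>The biconjugate on the unit interval\<close>

lemma conjugate01_le:
  assumes "\<And>t. t \<in> {0..1} \<Longrightarrow> s * t - g t \<le> c"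
  shows "conjugate01 g s \<le> c"
  unfolding conjugate01_def by (rule cSUP_least) (use assms in auto)

text \<open>As \<open>g\<close> is nonnegative, the values \<open>s * u - g u\<close> are at most
  \<open>\<bar>s\<bar>\<close> on the unit interval, so the \<open>SUP\<close> is a true
  supremum.\<close>

lemma conjugate01_ge:
  assumes "\<And>t. t \<in> {0..1} \<Longrightarrow> 0 \<le> g t" and "t \<in> {0..1}"
  shows "s * t - g t \<le> conjugate01 g s"
  unfolding conjugate01_def
proof (rule cSUP_upper[OF assms(2)], rule bdd_aboveI2)
  fix u :: real assume "u \<in> {0..1}"
  then have "s * u \<le> \<bar>s\<bar> * 1" "0 \<le> g u"
    using assms(1) by (auto simp: abs_le_iff intro: order_trans[OF abs_ge_self] simp: abs_mult mult_left_le)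
  then show "s * u - g u \<le> \<bar>s\<bar>" by linarith
qed

text \<open>By the Fenchel-Young inequality \<open>g t\<close> bounds the values of all these lines
  at \<open>t\<close>, so the \<open>SUP\<close> is a true supremum.\<close>

lemma biconjugate01_ge:
  assumes "\<And>t. t \<in> {0..1} \<Longrightarrow> 0 \<le> g t" and "t \<in> {0..1}"
  shows "s * t - conjugate01 g s \<le> biconjugate01 g t"
  unfolding biconjugate01_def
proof (rule cSUP_upper, simp, rule bdd_aboveI2)
  show "u * t - conjugate01 g u \<le> g t" for u
    using conjugate01_ge[of g t u] assms by simp
qed

lemma biconjugate01_le:
  assumes "\<And>s. s * t - conjugate01 g s \<le> c"
  shows "biconjugate01 g t \<le> c"
  unfolding biconjugate01_def by (rule cSUP_least) (use assms in auto)

lemma biconjugate01_near: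
  assumes "0 < e"
  obtains s where "biconjugate01 g t - e < s * t - conjugate01 g s"
proof -
  have "\<exists>s. biconjugate01 g t - e < s * t - conjugate01 g s"
  proof (rule ccontr)
    assume "\<not> ?thesis"
    then have "biconjugate01 g t \<le> biconjugate01 g t - e"
      by (intro biconjugate01_le) (simp add: not_less)
    then show False using assms by simp
  qed
  then show ?thesis using that by blast
qed

text \<open>Every line entering the biconjugate lies below \<open>g\<close>, and affine functions
  commute with convex combinations.\<close>

lemma biconjugate01_le_convex_comb:
  assumes g: "\<And>t. t \<in> {0..1} \<Longrightarrow> 0 \<le> g t"
    and t: "t1 \<in> {0..1}" "t2 \<in> {0..1}" and w: "w \<in> {0..1}"
  shows "biconjugate01 g (w * t1 + (1 - w) * t2) \<le> w * g t1 + (1 - w) * g t2"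
proof (rule biconjugate01_le)
  fix s
  have "w * (s * t1 - g t1) \<le> w * conjugate01 g s"
    "(1 - w) * (s * t2 - g t2) \<le> (1 - w) * conjugate01 g s"
    using conjugate01_ge[where g = g and s = s, OF g t(1)] conjugate01_ge[where g = g and s = s, OF g t(2)] w
    by (auto intro!: mult_left_mono)
  then show "s * (w * t1 + (1 - w) * t2) - conjugate01 g s \<le> w * g t1 + (1 - w) * g t2"
    by (simp add: algebra_simps)
qed

text \<open>The highest line of slope \<open>s\<close> below \<open>g\<close> has intercept
  \<open>- conjugate01 g s\<close>, and it is one of the lines entering the biconjugate.\<close>

lemma le_biconjugate01_if_supporting_line:
  assumes g: "\<And>t. t \<in> {0..1} \<Longrightarrow> 0 \<le> g t" and \<theta>: "\<theta> \<in> {0..1}"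
    and line: "\<And>t. t \<in> {0..1} \<Longrightarrow> m + s * (t - \<theta>) \<le> g t"
  shows "m \<le> biconjugate01 g \<theta>"
proof -
  have "conjugate01 g s \<le> s * \<theta> - m"
    using line by (intro conjugate01_le) (simp add: algebra_simps)
  then show ?thesis using biconjugate01_ge[where g = g and s = s, OF g \<theta>] by simp
qed

text \<open>In the interior a supporting line of the convex hull exists without any regularity of \<open>g\<close>,
  since the slopes from the left of \<open>\<theta>\<close> lie below those from the right.\<close>
lemma biconjugate01_two_point_interior:
  assumes g: "\<And>t. t \<in> {0..1} \<Longrightarrow> 0 \<le> g t" and \<theta>: "0 < \<theta>" "\<theta> < 1" and e: "0 < e"
  obtains w t1 t2 where "w \<in> {0..1}" "t1 \<in> {0..1}" "t2 \<in> {0..1}" "w * t1 + (1 - w) * t2 = \<theta>"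
    "w * g t1 + (1 - w) * g t2 \<le> biconjugate01 g \<theta> + e"
proof -
  \<comment> \<open>If all chords over \<theta> stayed above \<open>m\<close>, some line through
    (\<theta>, m) would run below \<open>g\<close> and force \<open>m\<close> below the biconjugate,
    which it exceeds by \<open>e\<close>.\<close>
  define m where "m = biconjugate01 g \<theta> + e"
  have "\<exists>w\<in>{0..1}. \<exists>t1\<in>{0..1}. \<exists>t2\<in>{0..1}. w * t1 + (1 - w) * t2 = \<theta> \<and>
    w * g t1 + (1 - w) * g t2 \<le> m"
  proof (rule ccontr)
    assume neg: "\<not> ?thesis"
    have chord: "m < w * g t1 + (1 - w) * g t2"
      if "w \<in> {0..1}" "t1 \<in> {0..1}" "t2 \<in> {0..1}" "w * t1 + (1 - w) * t2 = \<theta>" for w t1 t2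
    proof (rule ccontr)
      assume "\<not> m < w * g t1 + (1 - w) * g t2"
      then have "w * g t1 + (1 - w) * g t2 \<le> m" by simp
      then show False using neg that by blast
    qed
    \<comment> \<open>Cleared of denominators, this says that the chord from \<open>a\<close> to
      \<open>b\<close> passes above (\<theta>, m); \<open>w\<close> is the barycentric weight of
      \<theta>.\<close>
    have slopes: "(m - g a) / (\<theta> - a) \<le> (g b - m) / (b - \<theta>)"
      if a: "a \<in> {0..<\<theta>}" and b: "b \<in> {\<theta><..1}" for a b
    proof -
      define w where "w = (b - \<theta>) / (b - a)"
      have ba: "0 < b - a" using a b by auto
      have w1: "1 - w = (\<theta> - a) / (b - a)" using ba by (simp add: w_def field_simps)
      have "w \<in> {0..1}" using a b by (simp add: w_def)
      moreover have "w * a + (1 - w) * b = \<theta>"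
      proof -
        have "w * a + (1 - w) * b = ((b - \<theta>) * a + (\<theta> - a) * b) / (b - a)"
          unfolding w1 by (simp add: w_def add_divide_distrib)
        also have "(b - \<theta>) * a + (\<theta> - a) * b = \<theta> * (b - a)" by (simp add: algebra_simps)
        finally show ?thesis using ba by simp
      qed
      ultimately have "m < w * g a + (1 - w) * g b" using a b \<theta> by (intro chord) auto
      also have "\<dots> = ((b - \<theta>) * g a + (\<theta> - a) * g b) / (b - a)"
        unfolding w1 by (simp add: w_def add_divide_distrib)
      finally have "m * (b - a) < (b - \<theta>) * g a + (\<theta> - a) * g b"
        using ba by (simp add: pos_less_divide_eq)
      then have "(m - g a) * (b - \<theta>) \<le> (g b - m) * (\<theta> - a)" by (simp add: algebra_simps)
      then show ?thesis using a b by (simp add: divide_simps mult.commute)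
    qed
    \<comment> \<open>Any slope separating the left slopes from the right ones would do. The
      supremum of the left slopes is finite because \<theta> < 1 leaves the right slope at 1 as a
      bound.\<close>
    define s where "s = (SUP a\<in>{0..<\<theta>}. (m - g a) / (\<theta> - a))"
    have left: "(m - g a) / (\<theta> - a) \<le> s" if "a \<in> {0..<\<theta>}" for a
      unfolding s_def
    proof (rule cSUP_upper[OF that], rule bdd_aboveI2)
      show "(m - g u) / (\<theta> - u) \<le> (g 1 - m) / (1 - \<theta>)" if "u \<in> {0..<\<theta>}" for u
        using slopes[OF that, of 1] \<theta> by auto
    qed
    have right: "s \<le> (g b - m) / (b - \<theta>)" if "b \<in> {\<theta><..1}" for b
      unfolding s_def using \<theta> that by (intro cSUP_least slopes) auto
    have "m \<le> biconjugate01 g \<theta>"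
    proof (rule le_biconjugate01_if_supporting_line[OF g])
      fix t :: real assume t: "t \<in> {0..1}"
      consider "t < \<theta>" | "t = \<theta>" | "\<theta> < t" by linarith
      then show "m + s * (t - \<theta>) \<le> g t"
      proof cases
        case 1
        then have "m - g t \<le> s * (\<theta> - t)"
          using left[of t] t by (auto simp: pos_divide_le_eq)
        then show ?thesis by (simp add: algebra_simps)
      next
        case 2
        \<comment> \<open>The degenerate chord with both ends at \<theta> gives
          \<open>m < g \<theta>\<close>.\<close>
        then show ?thesis using chord[of 1 \<theta> \<theta>] \<theta> by simp
      next
        case 3
        then show ?thesis using right[of t] t by (auto simp: pos_le_divide_eq)
      qed
    qed (use \<theta> in auto)
    then show False using e by (simp add: m_def)
  qed
  then show ?thesis using that unfolding m_def by blast
qed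

text \<open>At the endpoint there are no slopes from the right, and lower semicontinuity replaces
  them. With slope \<open>g 1 / \<delta>\<close> the line stays below \<open>g 1 - e\<close> near 1
  and is at most \<open>- e\<close> from \<open>1 - \<delta>\<close> downwards, where
  \<open>g\<close> is nonnegative.\<close>

lemma le_biconjugate01_at_1:
  assumes g: "\<And>t. t \<in> {0..1} \<Longrightarrow> 0 \<le> g t" and \<delta>: "0 < \<delta>" and "0 \<le> e"
    and lsc: "\<And>t. t \<in> {0..1} \<Longrightarrow> 1 - \<delta> < t \<Longrightarrow> g 1 - e \<le> g t"
  shows "g 1 - e \<le> biconjugate01 g 1"
proof (rule le_biconjugate01_if_supporting_line[OF g])
  fix t :: real assume t: "t \<in> {0..1}"
  have g1: "0 \<le> g 1" using g by simp
  show "g 1 - e + g 1 / \<delta> * (t - 1) \<le> g t"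
  proof (cases "1 - \<delta> < t")
    case True
    have "g 1 / \<delta> * (t - 1) \<le> 0"
      using t g1 \<delta> by (intro mult_nonneg_nonpos) auto
    then show ?thesis using lsc[OF t True] by linarith
  next
    case False
    then have "g 1 / \<delta> * (t - 1) \<le> g 1 / \<delta> * (- \<delta>)"
      using g1 \<delta> by (intro mult_left_mono) auto
    then show ?thesis using \<delta> g[OF t] \<open>0 \<le> e\<close> by simp
  qed
qed auto

section \<open>The psi-transform\<close>

lemma C_risk_nonneg:
  assumes "\<And>x. 0 \<le> \<phi> x" and "\<eta> \<in> {0..1}"
  shows "0 \<le> C_risk \<phi> \<eta> \<alpha>"
  using assms by (simp add: C_risk_def)

lemma H_opt_le:
  assumes "\<And>x. 0 \<le> \<phi> x" and "\<eta> \<in> {0..1}"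
  shows "H_opt \<phi> \<eta> \<le> C_risk \<phi> \<eta> \<alpha>"
  unfolding H_opt_def
  by (rule cINF_lower) (auto intro!: bdd_belowI2[where m=0] C_risk_nonneg assms)

lemma H_opt_near:
  assumes "0 < e"
  obtains \<alpha> where "C_risk \<phi> \<eta> \<alpha> < H_opt \<phi> \<eta> + e"
proof -
  have "\<exists>\<alpha>. C_risk \<phi> \<eta> \<alpha> < H_opt \<phi> \<eta> + e"
  proof (rule ccontr)
    assume "\<not> ?thesis"
    then have "H_opt \<phi> \<eta> + e \<le> H_opt \<phi> \<eta>"
      by (subst (2) H_opt_def, intro cINF_greatest) (auto simp: not_less)
    then show False using assms by simp
  qed
  then show ?thesis using that by blast
qed

lemma H_minus_le:
  assumes "\<And>x. 0 \<le> \<phi> x" and "\<eta> \<in> {0..1}" and "\<alpha> * (2 * \<eta> - 1) \<le> 0"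
  shows "H_minus \<phi> \<eta> \<le> C_risk \<phi> \<eta> \<alpha>"
  unfolding H_minus_def
  by (rule cINF_lower) (auto intro!: bdd_belowI2[where m=0] C_risk_nonneg assms)

lemma H_minus_ge:
  assumes "\<And>\<alpha>. \<alpha> * (2 * \<eta> - 1) \<le> 0 \<Longrightarrow> c \<le> C_risk \<phi> \<eta> \<alpha>"
  shows "c \<le> H_minus \<phi> \<eta>"
  unfolding H_minus_def by (rule cINF_greatest) (use assms in \<open>auto intro: exI[of _ 0]\<close>)

text \<open>Here \<open>usc_at_zero\<close> replaces the score \<open>0\<close> by a nearby negative one.\<close>
lemma H_minus_near_negative:
  assumes "usc_at_zero \<phi>" and \<eta>: "\<eta> \<in> {1/2..1}" and e: "0 < e"
  obtains \<alpha> where "\<alpha> < 0" "C_risk \<phi> \<eta> \<alpha> < H_minus \<phi> \<eta> + e"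
proof -
  obtain \<alpha> where \<alpha>: "\<alpha> * (2 * \<eta> - 1) \<le> 0" "C_risk \<phi> \<eta> \<alpha> < H_minus \<phi> \<eta> + e / 2"
  proof -
    have "\<exists>\<alpha>. \<alpha> * (2 * \<eta> - 1) \<le> 0 \<and> C_risk \<phi> \<eta> \<alpha> < H_minus \<phi> \<eta> + e / 2"
    proof (rule ccontr)
      assume "\<not> ?thesis"
      then have "H_minus \<phi> \<eta> + e / 2 \<le> H_minus \<phi> \<eta>"
        by (intro H_minus_ge) (auto simp: not_less)
      then show False using e by simp
    qed
    then show ?thesis using that by blast
  qed
  consider "\<alpha> < 0" | "\<alpha> = 0" | "0 < \<alpha>" by linarith
  then show ?thesis
  proof cases
    case 1
    then show ?thesis using \<alpha> e by (intro that[of \<alpha>]) auto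
  next
    case 2
    have "\<forall>\<^sub>F x in at 0. \<phi> x < \<phi> 0 + e / 2"
      using assms(1) e by (simp add: usc_at_zero_def)
    then obtain d where d: "0 < d" "\<And>x. x \<noteq> 0 \<Longrightarrow> \<bar>x\<bar> < d \<Longrightarrow> \<phi> x < \<phi> 0 + e / 2"
      by (auto simp: eventually_at)
    have "\<phi> (- (d / 2)) < \<phi> 0 + e / 2" "\<phi> (d / 2) < \<phi> 0 + e / 2"
      using d by (auto intro!: d(2))
    then have "\<eta> * \<phi> (- (d / 2)) \<le> \<eta> * (\<phi> 0 + e / 2)"
      "(1 - \<eta>) * \<phi> (d / 2) \<le> (1 - \<eta>) * (\<phi> 0 + e / 2)"
      using \<eta> by (auto intro!: mult_left_mono)
    then have "C_risk \<phi> \<eta> (- (d / 2)) \<le> C_risk \<phi> \<eta> 0 + e / 2"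
      by (simp add: C_risk_def algebra_simps diff_divide_distrib)
    then show ?thesis using \<alpha>(2) 2 d(1) by (intro that[of "- (d / 2)"]) auto
  next
    case 3
    \<comment> \<open>A positive score meets the constraint only at \<eta> = 1/2, where
      \<open>C_risk\<close> is even in the score, so the sign can be flipped.\<close>
    then have "\<eta> = 1 / 2" using \<alpha>(1) \<eta> by (auto simp: mult_le_0_iff)
    then have "C_risk \<phi> \<eta> (- \<alpha>) = C_risk \<phi> \<eta> \<alpha>"
      by (simp only: C_risk_def) simp
    then show ?thesis using \<alpha>(2) 3 e by (intro that[of "- \<alpha>"]) auto
  qed
qed

lemma psi_tilde_nonneg:
  assumes \<phi>: "\<And>x. 0 \<le> \<phi> x" and "t \<in> {0..1}"
  shows "0 \<le> psi_tilde \<phi> t"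
  using H_minus_ge[of "(1 + t) / 2" "H_opt \<phi> ((1 + t) / 2)" \<phi>] H_opt_le[of \<phi> "(1 + t) / 2"] assms
  by (simp add: psi_tilde_def)

text \<open>At \<eta> = 1/2 the sign constraint in \<open>H_minus\<close> is vacuous.\<close>

lemma psi_tilde_0: "psi_tilde \<phi> 0 = 0"
  by (simp add: psi_tilde_def H_minus_def H_opt_def)

text \<open>This serves the endpoint \<theta> = 1. As \<eta> tends to 1, \<open>H_minus\<close>
  keeps at least the fraction \<eta> of its value at 1, while one fixed score with small loss keeps
  \<open>H_opt\<close> small.\<close>

lemma psi_tilde_lsc_at_1:
  assumes \<phi>: "\<And>x. 0 \<le> \<phi> x" and lim: "(\<phi> \<longlongrightarrow> 0) at_top" and e: "0 < e"
  obtains \<delta> where "0 < \<delta>"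
    "\<And>t. t \<in> {0..1} \<Longrightarrow> 1 - \<delta> < t \<Longrightarrow> psi_tilde \<phi> 1 - e \<le> psi_tilde \<phi> t"
proof -
  obtain \<alpha> where \<alpha>: "\<phi> \<alpha> < e / 3"
    using order_tendstoD(2)[OF lim, of "e / 3"] e eventually_happens[of _ at_top] by fastforce
  \<comment> \<open>\<open>M\<close> adds the coefficients of 1 - \<eta> in the two estimates below:
    the drop of \<open>H_minus\<close> and the cost of the score \<alpha> on the label -1.\<close>
  define M where "M = H_minus \<phi> 1 + \<phi> (- \<alpha>)"
  have M: "0 \<le> M"
    using H_minus_ge[of 1 0 \<phi>] \<phi> by (simp add: M_def C_risk_def)
  show ?thesis
  proof (rule that[of "e / (3 * (M + 1))"])
    show "0 < e / (3 * (M + 1))" using e M by simp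
    fix t :: real assume t: "t \<in> {0..1}" and "1 - e / (3 * (M + 1)) < t"
    define \<eta> where "\<eta> = (1 + t) / 2"
    have \<eta>: "\<eta> \<in> {1/2..1}" using t by (simp add: \<eta>_def)
    have "1 - \<eta> \<le> 1 - t" using t by (simp add: \<eta>_def)
    also have "\<dots> \<le> e / (3 * (M + 1))" using \<open>1 - e / (3 * (M + 1)) < t\<close> by linarith
    finally have "1 - \<eta> \<le> e / (3 * (M + 1))" .
    then have "(1 - \<eta>) * (3 * (M + 1)) \<le> e" using M by (simp add: pos_le_divide_eq)
    then have small: "(1 - \<eta>) * M \<le> e / 3" using \<eta> by (simp add: algebra_simps)
    have "\<eta> * H_minus \<phi> 1 \<le> H_minus \<phi> \<eta>"
    proof (cases "\<eta> = 1/2")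
      case False
      show ?thesis
      proof (rule H_minus_ge)
        fix a :: real assume "a * (2 * \<eta> - 1) \<le> 0"
        then have "a \<le> 0" using \<eta> False by (auto simp: mult_le_0_iff)
        then have "\<eta> * H_minus \<phi> 1 \<le> \<eta> * \<phi> a"
          using H_minus_le[of \<phi> 1 a] \<phi> \<eta> by (intro mult_left_mono) (auto simp: C_risk_def)
        also have "\<dots> \<le> C_risk \<phi> \<eta> a" using \<phi> \<eta> by (simp add: C_risk_def)
        finally show "\<eta> * H_minus \<phi> 1 \<le> C_risk \<phi> \<eta> a" .
      qed
    next
      case True
      show ?thesis
      proof (rule H_minus_ge)
        fix a :: real
        \<comment> \<open>At \<eta> = 1/2 both signs of \<open>a\<close> are allowed, but the loss
          at the nonpositive one of \<open>a\<close> and \<open>- a\<close> is always a summand of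
          twice \<open>C_risk\<close>.\<close>
        have "H_minus \<phi> 1 \<le> \<phi> (- \<bar>a\<bar>)"
          using H_minus_le[of \<phi> 1 "- \<bar>a\<bar>"] \<phi> by (simp add: C_risk_def)
        also have "\<dots> \<le> \<phi> a + \<phi> (- a)"
          using \<phi>[of a] \<phi>[of "- a"] by (cases "0 \<le> a") auto
        finally show "\<eta> * H_minus \<phi> 1 \<le> C_risk \<phi> \<eta> a" unfolding C_risk_def True by simp
      qed
    qed
    moreover have "H_opt \<phi> \<eta> \<le> e / 3 + (1 - \<eta>) * \<phi> (- \<alpha>)"
    proof -
      have "\<eta> * \<phi> \<alpha> \<le> 1 * \<phi> \<alpha>" using \<eta> \<phi> by (intro mult_right_mono) auto
      then show ?thesis
        using H_opt_le[of \<phi> \<eta> \<alpha>] \<phi> \<eta> \<alpha> by (simp add: C_risk_def)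
    qed
    moreover have "0 \<le> H_opt \<phi> 1"
      unfolding H_opt_def by (rule cINF_greatest) (use \<phi> in \<open>auto simp: C_risk_def\<close>)
    ultimately show "psi_tilde \<phi> 1 - e \<le> psi_tilde \<phi> t"
      using small e by (simp add: psi_tilde_def M_def algebra_simps flip: \<eta>_def)
  qed
qed

section \<open>Two-point representation, monotonicity and semicontinuity of \<psi>\<close>

lemma psi_eq_biconjugate: "0 \<le> t \<Longrightarrow> psi \<phi> t = biconjugate01 (psi_tilde \<phi>) t"
  by (simp add: psi_def)

text \<open>In the interior the pair comes from a near-optimal chord. At 0 and 1 a single point
  suffices: at 0 by \<open>psi_tilde_0\<close>, at 1 by lower semicontinuity of
  \<open>psi_tilde\<close>.\<close>

lemma psi_two_point:
  assumes \<phi>: "\<And>x. 0 \<le> \<phi> x" and lim: "(\<phi> \<longlongrightarrow> 0) at_top"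
    and \<theta>: "\<theta> \<in> {0..1}" and e: "0 < e"
  obtains w t1 t2 where "w \<in> {0..1}" "t1 \<in> {0..1}" "t2 \<in> {0..1}" "w * t1 + (1 - w) * t2 = \<theta>"
    "psi \<phi> \<theta> \<le> w * psi_tilde \<phi> t1 + (1 - w) * psi_tilde \<phi> t2"
    "w * psi_tilde \<phi> t1 + (1 - w) * psi_tilde \<phi> t2 \<le> psi \<phi> \<theta> + e"
proof -
  note result = that
  let ?g = "psi_tilde \<phi>"
  have g: "0 \<le> ?g t" if "t \<in> {0..1}" for t using psi_tilde_nonneg[of \<phi>, OF \<phi> that] .
  have hull: thesis if w: "w \<in> {0..1}" "t1 \<in> {0..1}" "t2 \<in> {0..1}" "w * t1 + (1 - w) * t2 = \<theta>"
    and le: "w * ?g t1 + (1 - w) * ?g t2 \<le> biconjugate01 ?g \<theta> + e" for w t1 t2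
  proof (rule result[OF w])
    show "psi \<phi> \<theta> \<le> w * ?g t1 + (1 - w) * ?g t2"
      using biconjugate01_le_convex_comb[of ?g, OF g w(2,3,1)] w(4) \<theta> by (simp add: psi_eq_biconjugate)
    show "w * ?g t1 + (1 - w) * ?g t2 \<le> psi \<phi> \<theta> + e"
      using le \<theta> by (simp add: psi_eq_biconjugate)
  qed
  consider "\<theta> = 0" | "0 < \<theta>" "\<theta> < 1" | "\<theta> = 1" using \<theta> by fastforce
  then show thesis
  proof cases
    case 1
    have "0 \<le> biconjugate01 ?g 0"
      by (rule le_biconjugate01_if_supporting_line[where s = 0]) (use g in auto)
    then show thesis using 1 e by (intro hull[of 1 0 0]) (auto simp: psi_tilde_0)
  next
    case 2
    then show thesis
      using biconjugate01_two_point_interior[of ?g \<theta> e] g e hull by blast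
  next
    case 3
    obtain \<delta> where \<delta>: "0 < \<delta>"
      "\<And>t. t \<in> {0..1} \<Longrightarrow> 1 - \<delta> < t \<Longrightarrow> psi_tilde \<phi> 1 - e \<le> psi_tilde \<phi> t"
      using psi_tilde_lsc_at_1[of \<phi>, OF \<phi> lim e] by blast
    have "?g 1 - e \<le> biconjugate01 ?g 1"
      using le_biconjugate01_at_1[of ?g \<delta> e] g \<delta> e by simp
    then show thesis using 3 by (intro hull[of 1 1 1]) auto
  qed
qed

lemma psi_nonneg:
  assumes "\<And>x. 0 \<le> \<phi> x" and "t \<le> 1"
  shows "0 \<le> psi \<phi> t"
proof (cases "t < 0")
  case False
  then have "0 \<le> biconjugate01 (psi_tilde \<phi>) t"
    using assms by (intro le_biconjugate01_if_supporting_line[where s = 0]) (auto simp: psi_tilde_nonneg)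
  then show ?thesis using False by (simp add: psi_def)
qed (simp add: psi_def)

lemma psi_0:
  assumes "\<And>x. 0 \<le> \<phi> x"
  shows "psi \<phi> 0 = 0"
proof (rule antisym)
  show "psi \<phi> 0 \<le> 0"
    using biconjugate01_le_convex_comb[of "psi_tilde \<phi>" 0 0 0] assms
    by (simp add: psi_eq_biconjugate psi_tilde_0 psi_tilde_nonneg)
qed (use assms psi_nonneg in auto)

text \<open>Lines of slope \<open>s \<ge> 0\<close> are nondecreasing. Lines of negative slope are
  at most 0 for \<open>t \<ge> 0\<close>, since \<open>psi_tilde_0\<close> makes every conjugate
  value nonnegative.\<close>

lemma psi_mono:
  assumes \<phi>: "\<And>x. 0 \<le> \<phi> x" and "t \<le> u" "u \<le> 1"
  shows "psi \<phi> t \<le> psi \<phi> u"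
proof (cases "t < 0")
  case True
  then show ?thesis using psi_nonneg[of \<phi>, OF \<phi> \<open>u \<le> 1\<close>] by (simp add: psi_def)
next
  case False
  let ?g = "psi_tilde \<phi>"
  have g: "0 \<le> ?g t" if "t \<in> {0..1}" for t using psi_tilde_nonneg[of \<phi>, OF \<phi> that] .
  have "biconjugate01 ?g t \<le> biconjugate01 ?g u"
  proof (rule biconjugate01_le)
    fix s
    show "s * t - conjugate01 ?g s \<le> biconjugate01 ?g u"
    proof (cases "0 \<le> s")
      case True
      then have "s * t \<le> s * u" using \<open>t \<le> u\<close> by (intro mult_left_mono) auto
      then show ?thesis using biconjugate01_ge[of ?g u s] g assms False by auto
    next
      case neg: False
      then have "s * t \<le> 0" using False by (intro mult_nonpos_nonneg) auto
      moreover have "0 \<le> conjugate01 ?g s"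
        using conjugate01_ge[of ?g 0 s] g by (simp add: psi_tilde_0)
      ultimately show ?thesis
        using psi_nonneg[of \<phi>, OF \<phi> \<open>u \<le> 1\<close>] False assms(2) by (simp add: psi_eq_biconjugate)
    qed
  qed
  then show ?thesis using False assms(2) by (simp add: psi_eq_biconjugate)
qed

text \<open>A line that nearly attains \<psi> at \<theta> changes little over a short step to the
  left and is still a lower bound for \<psi> there.\<close>

lemma psi_left_lsc:
  assumes \<phi>: "\<And>x. 0 \<le> \<phi> x" and \<theta>: "\<theta> \<in> {0..1}" and e: "0 < e"
  obtains \<delta> where "0 < \<delta>" "0 < \<theta> \<Longrightarrow> \<delta> \<le> \<theta>"
    "\<And>t. \<theta> - \<delta> \<le> t \<Longrightarrow> t \<le> \<theta> \<Longrightarrow> psi \<phi> \<theta> \<le> psi \<phi> t + e"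
proof (cases "\<theta> = 0")
  case True
  show ?thesis
    by (rule that[of 1]) (use True psi_0[of \<phi>, OF \<phi>] psi_nonneg[of \<phi>, OF \<phi>] e in \<open>auto intro: add_nonneg_nonneg\<close>)
next
  case False
  let ?g = "psi_tilde \<phi>"
  obtain s where s: "biconjugate01 ?g \<theta> - e / 2 < s * \<theta> - conjugate01 ?g s"
    using biconjugate01_near[of "e / 2" ?g \<theta>] e by auto
  \<comment> \<open>The cap at \<theta> keeps \<open>t\<close> nonnegative, where \<open>psi\<close>
    is the biconjugate; the other bound limits the change of the line to
    \<open>e / 2\<close>.\<close>
  define \<delta> where "\<delta> = min \<theta> (e / (2 * (\<bar>s\<bar> + 1)))"
  show ?thesis
  proof (rule that[of \<delta>])
    show "0 < \<delta>" using False \<theta> e by (simp add: \<delta>_def add_nonneg_pos)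
    show "\<delta> \<le> \<theta>" by (simp add: \<delta>_def)
    fix t assume t: "\<theta> - \<delta> \<le> t" "t \<le> \<theta>"
    have t0: "0 \<le> t" using t(1) by (simp add: \<delta>_def)
    have "\<theta> - t \<le> e / (2 * (\<bar>s\<bar> + 1))" using t by (simp add: \<delta>_def)
    then have "(\<theta> - t) * (2 * (\<bar>s\<bar> + 1)) \<le> e" by (simp add: pos_le_divide_eq)
    then have *: "\<bar>s\<bar> * (\<theta> - t) \<le> e / 2" using t(2) by (simp add: algebra_simps)
    have "s * (\<theta> - t) \<le> \<bar>s\<bar> * (\<theta> - t)" using t(2) by (intro mult_right_mono) auto
    then have "s * \<theta> \<le> s * t + e / 2" using * by (simp add: algebra_simps)
    moreover have "s * t - conjugate01 ?g s \<le> biconjugate01 ?g t"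
      using psi_tilde_nonneg[of \<phi>] \<phi> t0 t(2) \<theta> by (intro biconjugate01_ge) auto
    ultimately show "psi \<phi> \<theta> \<le> psi \<phi> t + e"
      using s t0 t(2) by (simp add: psi_eq_biconjugate)
  qed
qed

section \<open>Two-atom laws\<close>

abbreviation labelled_space :: "'v::topological_space set \<Rightarrow> ('v \<times> real) measure" where
  "labelled_space X \<equiv> restrict_space borel X \<Otimes>\<^sub>M count_space {-1, 1}"

text \<open>Conditioning on the first coin. As a rewrite rule it peels off the independent coins of
  the two-atom law in turn.\<close>

lemma expectation_pair_bernoulli_pmf:
  fixes g :: "bool \<times> 'a::finite \<Rightarrow> real"
  assumes "p \<in> {0..1}"
  shows "measure_pmf.expectation (pair_pmf (bernoulli_pmf p) q) g =
    p * measure_pmf.expectation q (\<lambda>c. g (True, c)) +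
    (1 - p) * measure_pmf.expectation q (\<lambda>c. g (False, c))"
proof -
  have fin: "measure_pmf.expectation r h = (\<Sum>a\<in>UNIV. h a * pmf r a)"
    for r :: "'b::finite pmf" and h :: "'b \<Rightarrow> real"
    by (rule integral_measure_pmf_real) auto
  have "measure_pmf.expectation (pair_pmf (bernoulli_pmf p) q) g =
      (\<Sum>b\<in>UNIV. \<Sum>c\<in>UNIV. g (b, c) * (pmf (bernoulli_pmf p) b * pmf q c))"
    unfolding fin[of "pair_pmf _ _"] UNIV_Times_UNIV[symmetric] sum.cartesian_product'
    by (simp add: pmf_pair)
  then show ?thesis
    using assms by (simp add: UNIV_bool fin sum_distrib_left mult_ac)
qed

text \<open>Labels for both atoms are drawn independently, and \<open>b\<close> selects the atom that is shown.\<close>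
definition two_atom_law ::
  "'v::topological_space set \<Rightarrow> real \<Rightarrow> 'v \<Rightarrow> real \<Rightarrow> 'v \<Rightarrow> real \<Rightarrow> ('v \<times> real) measure" where
  "two_atom_law X w x1 \<eta>1 x2 \<eta>2 =
     distr (measure_pmf (pair_pmf (bernoulli_pmf w) (pair_pmf (bernoulli_pmf \<eta>1) (bernoulli_pmf \<eta>2))))
       (labelled_space X)
       (\<lambda>(b, c1, c2). if b then (x1, if c1 then 1 else -1) else (x2, if c2 then 1 else -1))"

text \<open>The label factor is countable and discrete, so measurability can be checked on the slice
  of each label.\<close>

lemma measurable_labelled_space:
  assumes "\<And>y. y \<in> {-1, 1} \<Longrightarrow> (\<lambda>x. g (x, y)) \<in> borel_measurable (restrict_space borel X)"
  shows "g \<in> borel_measurable (labelled_space X)"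
proof (subst measurable_pair_swap_iff, rule measurable_pair_measure_countable1)
  show "(\<lambda>x. case (y, x) of (x, y) \<Rightarrow> g (y, x)) \<in> borel_measurable (restrict_space borel X)"
    if "y \<in> {-1, 1}" for y using assms[OF that] by simp
qed simp

lemma measurable_nat_loss:
  assumes [measurable]: "f \<in> borel_measurable borel"
  shows "nat_loss f \<in> borel_measurable (labelled_space X)"
proof (rule measurable_labelled_space)
  fix y :: real
  have "(\<lambda>x. of_bool (f x * y \<le> 0) :: real) \<in> borel_measurable borel"
    by measurable
  then show "(\<lambda>x. nat_loss f (x, y)) \<in> borel_measurable (restrict_space borel X)"
    by (auto simp: nat_loss_def intro: measurable_restrict_space1)
qed

context
  fixes X :: "'v::topological_space set" and w \<eta>1 \<eta>2 :: real and x1 x2 :: 'v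
  assumes x: "x1 \<in> X" "x2 \<in> X" and w: "w \<in> {0..1}" and \<eta>: "\<eta>1 \<in> {0..1}" "\<eta>2 \<in> {0..1}"
begin

lemma measurable_two_atom:
  "(\<lambda>(b, c1, c2). if b then (x1, if c1 then 1 else -1) else (x2, if c2 then 1 else -1))
    \<in> measurable (measure_pmf p) (labelled_space X)"
  using x by (auto simp: space_pair_measure space_restrict_space split: prod.split)

lemma labelled_dist_two_atom_law: "labelled_dist X (two_atom_law X w x1 \<eta>1 x2 \<eta>2)"
  unfolding labelled_dist_def two_atom_law_def
  by (simp add: prob_space.prob_space_distr[OF prob_space_measure_pmf measurable_two_atom])

lemma sets_two_atom_law: "sets (two_atom_law X w x1 \<eta>1 x2 \<eta>2) = sets (labelled_space X)"
  by (simp add: two_atom_law_def)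

lemma integrable_two_atom_law:
  fixes g :: "'v \<times> real \<Rightarrow> real"
  assumes "g \<in> borel_measurable (labelled_space X)"
  shows "integrable (two_atom_law X w x1 \<eta>1 x2 \<eta>2) g"
  unfolding two_atom_law_def
  by (subst integrable_distr_eq[OF measurable_two_atom assms])
    (auto intro!: integrable_measure_pmf_finite intro: finite_subset[OF subset_UNIV])

lemma integral_two_atom_law:
  fixes g :: "'v \<times> real \<Rightarrow> real"
  assumes "g \<in> borel_measurable (labelled_space X)"
  shows "integral\<^sup>L (two_atom_law X w x1 \<eta>1 x2 \<eta>2) g =
    w * (\<eta>1 * g (x1, 1) + (1 - \<eta>1) * g (x1, -1)) +
    (1 - w) * (\<eta>2 * g (x2, 1) + (1 - \<eta>2) * g (x2, -1))"
  unfolding two_atom_law_def integral_distr[OF measurable_two_atom assms]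
  using w \<eta> by (simp add: expectation_pair_bernoulli_pmf algebra_simps)

text \<open>Every score errs on at least one label of each atom, at a cost of at least 1 - \<eta>
  when \<eta> \<ge> 1/2. The constant score 1 pays exactly this.\<close>

lemma R_nat_opt_two_atom_law:
  assumes "1/2 \<le> \<eta>1" "1/2 \<le> \<eta>2"
  shows "R_nat_opt (two_atom_law X w x1 \<eta>1 x2 \<eta>2) = w * (1 - \<eta>1) + (1 - w) * (1 - \<eta>2)"
proof -
  let ?P = "two_atom_law X w x1 \<eta>1 x2 \<eta>2"
  have R: "R_nat ?P f = w * (\<eta>1 * nat_loss f (x1, 1) + (1 - \<eta>1) * nat_loss f (x1, -1)) +
    (1 - w) * (\<eta>2 * nat_loss f (x2, 1) + (1 - \<eta>2) * nat_loss f (x2, -1))"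
    if "f \<in> borel_measurable borel" for f
    unfolding R_nat_def using measurable_nat_loss[OF that] by (rule integral_two_atom_law)
  have lower: "w * (1 - \<eta>1) + (1 - w) * (1 - \<eta>2) \<le> R_nat ?P f" if "f \<in> borel_measurable borel" for f
    unfolding R[OF that] using w \<eta> assms
    by (intro add_mono mult_left_mono) (auto simp: nat_loss_def)
  show ?thesis
    unfolding R_nat_opt_def
  proof (rule antisym)
    have "(INF f\<in>borel_measurable borel. R_nat ?P f) \<le> R_nat ?P (\<lambda>_. 1)"
      by (rule cINF_lower) (auto intro!: bdd_belowI2 lower)
    also have "\<dots> = w * (1 - \<eta>1) + (1 - w) * (1 - \<eta>2)"
      by (subst R) (auto simp: nat_loss_def)
    finally show "(INF f\<in>borel_measurable borel. R_nat ?P f) \<le> w * (1 - \<eta>1) + (1 - w) * (1 - \<eta>2)" .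
  qed (intro cINF_greatest lower; use borel_measurable_const in blast)
qed

lemma R_phi_two_atom_law:
  assumes "phi_loss \<phi> f \<in> borel_measurable (labelled_space X)"
  shows "R_phi \<phi> (two_atom_law X w x1 \<eta>1 x2 \<eta>2) f =
    w * C_risk \<phi> \<eta>1 (f x1) + (1 - w) * C_risk \<phi> \<eta>2 (f x2)"
  unfolding R_phi_def integral_two_atom_law[OF assms] by (simp add: phi_loss_def C_risk_def)

end

section \<open>Two-valued scores and the optimal \<phi>-risk\<close>

lemma measurable_two_valued:
  fixes x1 :: "'v::t1_space" and a1 a2 :: "'b::topological_space"
  shows "(\<lambda>x. if x = x1 then a1 else a2) \<in> borel_measurable borel"
  by (rule measurable_If) auto

text \<open>For a fixed label the loss has one value at the closed point \<open>x1\<close> and one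
  value elsewhere, so it is Borel for an arbitrary \<phi>.\<close>

lemma measurable_phi_loss_two_valued:
  fixes x1 :: "'v::t1_space"
  shows "phi_loss \<phi> (\<lambda>x. if x = x1 then a1 else a2) \<in> borel_measurable (labelled_space X)"
proof (rule measurable_labelled_space)
  fix y :: real
  have "(\<lambda>x. phi_loss \<phi> (\<lambda>x. if x = x1 then a1 else a2) (x, y)) =
      (\<lambda>x. if x = x1 then \<phi> (a1 * y) else \<phi> (a2 * y))"
    by (auto simp: phi_loss_def)
  then show "(\<lambda>x. phi_loss \<phi> (\<lambda>x. if x = x1 then a1 else a2) (x, y))
      \<in> borel_measurable (restrict_space borel X)"
    by (auto intro!: measurable_restrict_space1 measurable_two_valued)
qed

text \<open>As the atoms differ, their scores can be chosen independently, and the infimum of the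
  weighted sum splits.\<close>

lemma R_phi_opt_two_atom_law:
  fixes x1 x2 :: "'v::t1_space"
  assumes \<phi>: "\<And>x. 0 \<le> \<phi> x" and x: "x1 \<in> X" "x2 \<in> X" "x1 \<noteq> x2"
    and w: "w \<in> {0..1}" and \<eta>: "\<eta>1 \<in> {0..1}" "\<eta>2 \<in> {0..1}"
  shows "R_phi_opt \<phi> (two_atom_law X w x1 \<eta>1 x2 \<eta>2) = w * H_opt \<phi> \<eta>1 + (1 - w) * H_opt \<phi> \<eta>2"
proof -
  let ?P = "two_atom_law X w x1 \<eta>1 x2 \<eta>2"
  let ?F = "{f \<in> borel_measurable borel. integrable ?P (phi_loss \<phi> f)}"
  note R = R_phi_two_atom_law[OF x(1,2) w \<eta>]
  have lower: "w * H_opt \<phi> \<eta>1 + (1 - w) * H_opt \<phi> \<eta>2 \<le> R_phi \<phi> ?P f" if "f \<in> ?F" for f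
  proof -
    \<comment> \<open>Measurability of the loss is extracted from its integrability; for an
      arbitrary \<phi> it does not follow from that of \<open>f\<close>.\<close>
    have "phi_loss \<phi> f \<in> borel_measurable (labelled_space X)"
      using that borel_measurable_integrable measurable_cong_sets[OF sets_two_atom_law[OF x(1,2) w \<eta>] refl]
      by blast
    then show ?thesis
      using w by (auto simp: R intro!: add_mono mult_left_mono H_opt_le \<phi> \<eta>)
  qed
  show ?thesis
    unfolding R_phi_opt_def
  proof (rule antisym)
    show "(INF f\<in>?F. R_phi \<phi> ?P f) \<le> w * H_opt \<phi> \<eta>1 + (1 - w) * H_opt \<phi> \<eta>2"
    proof (rule field_le_epsilon)
      fix e :: real assume e: "0 < e"
      obtain a1 where a1: "C_risk \<phi> \<eta>1 a1 < H_opt \<phi> \<eta>1 + e" using H_opt_near[OF e] .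
      obtain a2 where a2: "C_risk \<phi> \<eta>2 a2 < H_opt \<phi> \<eta>2 + e" using H_opt_near[OF e] .
      let ?f = "\<lambda>x. if x = x1 then a1 else a2"
      have "?f \<in> ?F"
        using measurable_two_valued integrable_two_atom_law[OF x(1,2) w \<eta> measurable_phi_loss_two_valued]
        by auto
      then have "(INF f\<in>?F. R_phi \<phi> ?P f) \<le> R_phi \<phi> ?P ?f"
        by (rule cINF_lower[rotated]) (auto intro!: bdd_belowI2 lower)
      also have "\<dots> = w * C_risk \<phi> \<eta>1 a1 + (1 - w) * C_risk \<phi> \<eta>2 a2"
        using x(3) by (subst R[OF measurable_phi_loss_two_valued]) auto
      also have "\<dots> \<le> w * (H_opt \<phi> \<eta>1 + e) + (1 - w) * (H_opt \<phi> \<eta>2 + e)"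
        using w a1 a2 by (intro add_mono mult_left_mono) auto
      finally show "(INF f\<in>?F. R_phi \<phi> ?P f) \<le> w * H_opt \<phi> \<eta>1 + (1 - w) * H_opt \<phi> \<eta>2 + e"
        by (simp add: algebra_simps)
    qed
    \<comment> \<open>The zero score, written in two-valued form to reuse the lemmas above, shows
      that the infimum is over a nonempty set.\<close>
    have "(\<lambda>x. if x = x1 then 0 else 0 :: real) \<in> ?F"
      using measurable_two_valued integrable_two_atom_law[OF x(1,2) w \<eta> measurable_phi_loss_two_valued]
      by blast
    then have "?F \<noteq> {}" by blast
    then show "w * H_opt \<phi> \<eta>1 + (1 - w) * H_opt \<phi> \<eta>2 \<le> (INF f\<in>?F. R_phi \<phi> ?P f)"
      by (rule cINF_greatest) (rule lower)
  qed
qed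

section \<open>Robust loss and regularizer of a negative two-valued score\<close>

text \<open>In finite dimension a norm is convex, hence continuous. This makes the set of points
  whose ball contains \<open>x1\<close> measurable.\<close>

lemma is_norm_measurable:
  fixes N :: "'v::euclidean_space \<Rightarrow> real"
  assumes "is_norm N"
  shows "N \<in> borel_measurable borel"
proof -
  have tri: "N (a + b) \<le> N a + N b" for a b using assms by (simp add: is_norm_def)
  have "convex_on UNIV N"
  proof (rule convex_onI)
    fix t and u v :: 'v assume "0 < t" "t < (1::real)"
    have "N ((1 - t) *\<^sub>R u + t *\<^sub>R v) \<le> N ((1 - t) *\<^sub>R u) + N (t *\<^sub>R v)"
      by (rule tri)
    also have "\<dots> = (1 - t) * N u + t * N v"
      using assms \<open>0 < t\<close> \<open>t < 1\<close> by (simp add: is_norm_def)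
    finally show "N ((1 - t) *\<^sub>R u + t *\<^sub>R v) \<le> (1 - t) * N u + t * N v" .
  qed simp
  then show ?thesis
    by (intro borel_measurable_continuous_onI convex_on_continuous) auto
qed

lemma is_norm_0: "is_norm N \<Longrightarrow> N 0 = 0"
  by (simp add: is_norm_def)

lemma self_in_pert_ball: "is_norm N \<Longrightarrow> 0 \<le> eps \<Longrightarrow> x \<in> X \<Longrightarrow> x \<in> pert_ball X N eps x"
  by (simp add: pert_ball_def is_norm_0)

text \<open>A negative score is wrong for label 1 already at the centre of the ball, and right for
  label -1 throughout it.\<close>

lemma rob_loss_negative:
  assumes "is_norm N" "0 \<le> eps" and h: "\<And>x. h x < 0" and "x \<in> X" and "y \<in> {-1, 1}"
  shows "rob_loss X N eps h (x, y) = of_bool (y = 1)"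
proof (cases "y = 1")
  case True
  then show ?thesis
    using h self_in_pert_ball[OF assms(1,2) \<open>x \<in> X\<close>] by (auto simp: rob_loss_def intro: less_imp_le)
next
  case False
  then have "y = -1" using assms(5) by auto
  then show ?thesis using h by (auto simp: rob_loss_def not_le)
qed

lemma measurable_rob_loss_negative:
  assumes "is_norm N" "0 \<le> eps" "\<And>x. h x < 0"
  shows "rob_loss X N eps h \<in> borel_measurable (labelled_space X)"
proof (rule measurable_labelled_space)
  fix y :: real assume "y \<in> {-1, 1}"
  then show "(\<lambda>x. rob_loss X N eps h (x, y)) \<in> borel_measurable (restrict_space borel X)"
    by (subst measurable_cong[where g = "\<lambda>_. of_bool (y = 1)"])
      (auto simp: rob_loss_negative assms space_restrict_space)
qed

text \<open>Apart from the single point \<open>x1\<close>, the supremum depends on \<open>x\<close> only through whether the ball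
  around \<open>x\<close> contains \<open>x1\<close>; so no measurability of \<open>\<phi>\<close> is required.\<close>
lemma measurable_reg_loss_two_valued:
  fixes X :: "'v::euclidean_space set"
  assumes N: "is_norm N" and eps: "0 \<le> eps" and x1: "x1 \<in> X"
  shows "reg_loss \<phi> X N eps (\<lambda>x. if x = x1 then a1 else a2) lam \<in> borel_measurable (labelled_space X)"
proof (rule measurable_labelled_space)
  fix y :: real
  define f where "f = (\<lambda>x. if x = x1 then a1 else a2)"
  let ?r = "\<lambda>x. if x = x1 then reg_loss \<phi> X N eps f lam (x1, y)
    else if N (x1 - x) \<le> eps then (SUP v\<in>{a1, a2}. \<phi> (v * a2 / lam)) else \<phi> (a2 * a2 / lam)"
  have [measurable]: "N \<in> borel_measurable borel" by (rule is_norm_measurable[OF N])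
  have r: "?r \<in> borel_measurable borel" by measurable
  have eq: "reg_loss \<phi> X N eps f lam (x, y) = ?r x" if "x \<in> X" for x
  proof (cases "x = x1")
    case False
    have "f ` pert_ball X N eps x = (if N (x1 - x) \<le> eps then {a1, a2} else {a2})"
      using self_in_pert_ball[OF N eps that] False x1 by (auto simp: f_def pert_ball_def)
    moreover have "f x = a2" using False by (simp add: f_def)
    then have "reg_loss \<phi> X N eps f lam (x, y) =
        (SUP v\<in>f ` pert_ball X N eps x. \<phi> (v * a2 / lam))"
      by (simp add: reg_loss_def image_image)
    ultimately show ?thesis using False by simp
  qed simp
  have "(\<lambda>x. reg_loss \<phi> X N eps f lam (x, y)) \<in> borel_measurable (restrict_space borel X) \<longleftrightarrow>
      ?r \<in> borel_measurable (restrict_space borel X)"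
    by (rule measurable_cong, rule eq) (simp add: space_restrict_space)
  then show "(\<lambda>x. reg_loss \<phi> X N eps (\<lambda>x. if x = x1 then a1 else a2) lam (x, y))
      \<in> borel_measurable (restrict_space borel X)"
    using measurable_restrict_space1[OF r] unfolding f_def by blast
qed

lemma bdd_above_reg_two_valued:
  fixes \<phi> :: "real \<Rightarrow> real"
  shows "bdd_above ((\<lambda>x'. \<phi> ((if x' = x1 then a1 else a2) * (c::real) / lam)) ` B)"
proof -
  have "finite ((\<lambda>x'. \<phi> ((if x' = x1 then a1 else a2) * c / lam)) ` B)"
    by (rule finite_subset[of _ "{\<phi> (a1 * c / lam), \<phi> (a2 * c / lam)}"]) auto
  then show ?thesis by (rule bdd_above_finite)
qed

text \<open>Two scores of the same sign and size at least \<open>m\<close> have product at least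
  \<open>m * m\<close>; divided by \<open>lam\<close> it reaches the range where \<phi> is at most
  \<delta>.\<close>

lemma reg_loss_bounds:
  assumes N: "is_norm N" "0 \<le> eps" and x: "x \<in> X" and lam: "0 < lam"
    and bdd: "bdd_above ((\<lambda>x'. \<phi> (f x' * f x / lam)) ` pert_ball X N eps x)"
    and \<phi>: "\<And>z. 0 \<le> \<phi> z" "\<And>z. K \<le> z \<Longrightarrow> \<phi> z \<le> \<delta>"
    and f: "\<And>x. f x \<le> - m" "0 \<le> m" "K * lam \<le> m * m"
  shows "0 \<le> reg_loss \<phi> X N eps f lam (x, y)" "reg_loss \<phi> X N eps f lam (x, y) \<le> \<delta>"
proof -
  have self: "x \<in> pert_ball X N eps x" using self_in_pert_ball[OF N x] .
  show "0 \<le> reg_loss \<phi> X N eps f lam (x, y)"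
    using cSUP_upper2[OF bdd self] \<phi>(1) by (auto simp: reg_loss_def)
  have "\<phi> (f x' * f x / lam) \<le> \<delta>" for x'
  proof (rule \<phi>(2))
    have "m * m \<le> (- f x') * (- f x)" using f(1)[of x] f(1)[of x'] f(2) by (intro mult_mono) auto
    then show "K \<le> f x' * f x / lam" using f(3) lam by (simp add: pos_le_divide_eq)
  qed
  then show "reg_loss \<phi> X N eps f lam (x, y) \<le> \<delta>"
    using self by (auto simp: reg_loss_def intro!: cSUP_least)
qed

section \<open>The extremal law and score\<close>

theorem theorem3p2:
  fixes X :: "(real ^ 'd) set"
    and N :: "real ^ 'd \<Rightarrow> real"
    and eps :: real
    and \<phi> :: "real \<Rightarrow> real"
    and \<xi> \<theta> :: real
  assumes "is_norm N"
    and "0 \<le> eps"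
    and "\<exists>x\<in>X. \<exists>x'\<in>X. x \<noteq> x'"
    and "\<And>x. 0 \<le> \<phi> x"
    and "classification_calibrated \<phi>"
    and "usc_at_zero \<phi>"
    and "(\<phi> \<longlongrightarrow> 0) at_top"
    and "0 < \<xi>"
    and "0 \<le> \<theta>" and "\<theta> \<le> 1"
  shows "\<exists>P f lam.
           labelled_dist X P \<and> 0 < lam \<and> risks_exist \<phi> X N eps P f lam \<and>
           R_rob X N eps P f - R_nat_opt P = \<theta> \<and>
           (0 < \<theta> \<longrightarrow> 0 \<le> \<theta> - R_reg \<phi> X N eps P f lam) \<and>
           psi \<phi> (\<theta> - R_reg \<phi> X N eps P f lam) \<le> R_phi \<phi> P f - R_phi_opt \<phi> P \<and>
           R_phi \<phi> P f - R_phi_opt \<phi> P \<le> psi \<phi> (\<theta> - R_reg \<phi> X N eps P f lam) + \<xi>"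
proof -
  note \<phi> = assms(4)
  \<comment> \<open>One third of \<xi> each is spent on the two-point representation, on the scores
    nearly attaining \<open>H_minus\<close>, and on the shift of the argument of \<psi> by the
    regularizer.\<close>
  have \<theta>: "\<theta> \<in> {0..1}" and \<xi>: "0 < \<xi> / 3" using assms by auto
  obtain x1 x2 where x: "x1 \<in> X" "x2 \<in> X" "x1 \<noteq> x2" using assms(3) by blast
  obtain w t1 t2 where w: "w \<in> {0..1}" and t: "t1 \<in> {0..1}" "t2 \<in> {0..1}"
    and comb: "w * t1 + (1 - w) * t2 = \<theta>"
    and hull: "psi \<phi> \<theta> \<le> w * psi_tilde \<phi> t1 + (1 - w) * psi_tilde \<phi> t2"
      "w * psi_tilde \<phi> t1 + (1 - w) * psi_tilde \<phi> t2 \<le> psi \<phi> \<theta> + \<xi> / 3"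
    using psi_two_point[of \<phi>, OF \<phi> assms(7) \<theta> \<xi>] by metis
  define \<eta>1 \<eta>2 where \<eta>_def: "\<eta>1 = (1 + t1) / 2" "\<eta>2 = (1 + t2) / 2"
  have \<eta>: "\<eta>1 \<in> {1/2..1}" "\<eta>2 \<in> {1/2..1}" using t by (auto simp: \<eta>_def)
  then have \<eta>': "\<eta>1 \<in> {0..1}" "\<eta>2 \<in> {0..1}" by auto
  obtain \<delta> where \<delta>: "0 < \<delta>" "0 < \<theta> \<Longrightarrow> \<delta> \<le> \<theta>"
    "\<And>t. \<theta> - \<delta> \<le> t \<Longrightarrow> t \<le> \<theta> \<Longrightarrow> psi \<phi> \<theta> \<le> psi \<phi> t + \<xi> / 3"
    using psi_left_lsc[of \<phi>, OF \<phi> \<theta> \<xi>] by metis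
  obtain a1 where a1: "a1 < 0" "C_risk \<phi> \<eta>1 a1 < H_minus \<phi> \<eta>1 + \<xi> / 3"
    using H_minus_near_negative[OF assms(6) \<eta>(1) \<xi>] .
  obtain a2 where a2: "a2 < 0" "C_risk \<phi> \<eta>2 a2 < H_minus \<phi> \<eta>2 + \<xi> / 3"
    using H_minus_near_negative[OF assms(6) \<eta>(2) \<xi>] .
  define f where "f = (\<lambda>x. if x = x1 then a1 else a2)"
  define m where "m = min (- a1) (- a2)"
  have m: "0 < m" and fm: "\<And>x. f x \<le> - m" using a1 a2 by (auto simp: f_def m_def)
  have neg: "f x < 0" for x using fm[of x] m by linarith
  obtain K where K: "\<And>z. K \<le> z \<Longrightarrow> \<phi> z \<le> \<delta>" "0 < K"
  proof -
    have "\<forall>\<^sub>F z in at_top. \<phi> z < \<delta>" using order_tendstoD(2)[OF assms(7) \<delta>(1)] .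
    then obtain K where "\<And>z. K \<le> z \<Longrightarrow> \<phi> z < \<delta>" by (auto simp: eventually_at_top_linorder)
    then show ?thesis by (intro that[of "max K 1"]) (auto intro: less_imp_le)
  qed
  \<comment> \<open>The largest \<lambda> for which every product of two scores, divided by
    \<lambda>, is guaranteed to reach \<open>K\<close> by the bound \<open>m * m\<close>.\<close>
  define lam where "lam = m * m / K"
  have lam: "0 < lam" "K * lam \<le> m * m" using m K(2) by (auto simp: lam_def)
  define P where "P = two_atom_law X w x1 \<eta>1 x2 \<eta>2"
  note integrable = integrable_two_atom_law[OF x(1,2) w \<eta>', folded P_def]
    and integral = integral_two_atom_law[OF x(1,2) w \<eta>', folded P_def]
  have meas: "f \<in> borel_measurable borel" "phi_loss \<phi> f \<in> borel_measurable (labelled_space X)"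
    "rob_loss X N eps f \<in> borel_measurable (labelled_space X)"
    "reg_loss \<phi> X N eps f lam \<in> borel_measurable (labelled_space X)"
    using measurable_rob_loss_negative[OF assms(1,2) neg]
      measurable_reg_loss_two_valued[OF assms(1,2) x(1)]
    unfolding f_def by (auto intro: measurable_two_valued measurable_phi_loss_two_valued)
  have bdd: "bdd_above ((\<lambda>x'. \<phi> (f x' * f x / lam)) ` pert_ball X N eps x)" for x
    unfolding f_def by (rule bdd_above_reg_two_valued)
  have rob: "R_rob X N eps P f - R_nat_opt P = \<theta>"
  proof -
    \<comment> \<open>The robust error is the mass of label 1, so the excess is the average of 2 *
      \<eta> - 1 over the atoms, that is of \<open>t1\<close> and \<open>t2\<close>.\<close>
    have "R_rob X N eps P f = w * \<eta>1 + (1 - w) * \<eta>2"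
      unfolding R_rob_def integral[OF meas(3)]
      using x by (simp add: rob_loss_negative[OF assms(1,2) neg])
    moreover have "R_nat_opt P = w * (1 - \<eta>1) + (1 - w) * (1 - \<eta>2)"
      unfolding P_def using \<eta> by (intro R_nat_opt_two_atom_law x w \<eta>') auto
    ultimately show ?thesis using comb by (simp add: \<eta>_def field_simps)
  qed
  define r where "r = R_reg \<phi> X N eps P f lam"
  have r: "0 \<le> r" "r \<le> \<delta>"
  proof -
    note b = reg_loss_bounds[OF assms(1,2) _ lam(1) bdd \<phi> K(1) fm less_imp_le[OF m] lam(2)]
    have r_eq: "r = w * (\<eta>1 * reg_loss \<phi> X N eps f lam (x1, 1) + (1 - \<eta>1) * reg_loss \<phi> X N eps f lam (x1, -1)) +
      (1 - w) * (\<eta>2 * reg_loss \<phi> X N eps f lam (x2, 1) + (1 - \<eta>2) * reg_loss \<phi> X N eps f lam (x2, -1))"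
      unfolding r_def R_reg_def by (rule integral[OF meas(4)])
    show "0 \<le> r"
      unfolding r_eq using w \<eta>' x b(1) by auto
    show "r \<le> \<delta>"
      unfolding r_eq using w \<eta>' x b(2) by (intro convex_bound_le) auto
  qed
  have excess: "R_phi \<phi> P f - R_phi_opt \<phi> P =
    w * (C_risk \<phi> \<eta>1 a1 - H_opt \<phi> \<eta>1) + (1 - w) * (C_risk \<phi> \<eta>2 a2 - H_opt \<phi> \<eta>2)"
  proof -
    have "R_phi \<phi> P f = w * C_risk \<phi> \<eta>1 a1 + (1 - w) * C_risk \<phi> \<eta>2 a2"
      unfolding P_def R_phi_two_atom_law[OF x(1,2) w \<eta>' meas(2)] using x(3) by (simp add: f_def)
    then show ?thesis
      unfolding P_def R_phi_opt_two_atom_law[of \<phi>, OF \<phi> x w \<eta>'] by (simp add: algebra_simps)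
  qed
  \<comment> \<open>Negative scores are admissible in \<open>H_minus\<close>, so the lower bound
    holds without any loss in \<xi>.\<close>
  have "H_minus \<phi> \<eta>1 \<le> C_risk \<phi> \<eta>1 a1" "H_minus \<phi> \<eta>2 \<le> C_risk \<phi> \<eta>2 a2"
    using \<eta> a1(1) a2(1) by (auto intro!: H_minus_le \<phi> mult_nonpos_nonneg)
  then have
    lower: "w * psi_tilde \<phi> t1 + (1 - w) * psi_tilde \<phi> t2 \<le> R_phi \<phi> P f - R_phi_opt \<phi> P"
    unfolding excess using w by (intro add_mono mult_left_mono) (auto simp: psi_tilde_def \<eta>_def)
  have "R_phi \<phi> P f - R_phi_opt \<phi> P \<le> w * (psi_tilde \<phi> t1 + \<xi> / 3) + (1 - w) * (psi_tilde \<phi> t2 + \<xi> / 3)"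
    unfolding excess using w a1(2) a2(2)
    by (intro add_mono mult_left_mono) (auto simp: psi_tilde_def \<eta>_def)
  then have upper: "R_phi \<phi> P f - R_phi_opt \<phi> P \<le> w * psi_tilde \<phi> t1 + (1 - w) * psi_tilde \<phi> t2 + \<xi> / 3"
    by (simp add: algebra_simps diff_divide_distrib)
  have "psi \<phi> (\<theta> - r) \<le> psi \<phi> \<theta>" using r \<theta> by (intro psi_mono[of \<phi>, OF \<phi>]) auto
  moreover have "psi \<phi> \<theta> \<le> psi \<phi> (\<theta> - r) + \<xi> / 3" using r by (intro \<delta>(3)) auto
  \<comment> \<open>Since \<delta> \<le> \<theta> here, the argument of \<psi> stays in the unit
    interval and the bounds do not rest on the extension by 0.\<close>
  moreover have "0 \<le> \<theta> - r" if "0 < \<theta>" using \<delta>(2)[OF that] r by linarith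
  moreover have "labelled_dist X P"
    unfolding P_def by (intro labelled_dist_two_atom_law x w \<eta>')
  moreover have "risks_exist \<phi> X N eps P f lam"
    unfolding risks_exist_def by (intro conjI ballI meas(1) integrable meas(2-4) bdd)
  ultimately show ?thesis
    using rob lam(1) hull lower upper unfolding r_def
    by (intro exI[of _ P] exI[of _ f] exI[of _ lam]) auto
qed

end
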